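(* Assume that there exist constants $C,\lambda>0$ and $\zeta\in(0,1]$, $\sigma_\epsilon$-invariant measurable sets $\Omega_\epsilon\subset\Omega$, $\epsilon\in I$, with $\mathbb P_\epsilon(\Omega_\epsilon)=1$, and for each $\epsilon\in I$ a family $(h_{\omega,\epsilon})_{\omega\in\Omega_\epsilon}\subset\mathcal B_s$ (with $h_\omega:=h_{\omega,0}$) such that: (A1) $\|\mathcal L_{\omega,\epsilon}^n h\|_w\le Ce^{-\lambda n}\|h\|_w$ for all $h\in\mathcal B_w$ with $\psi(h)=0$, $n\in\mathbb N$, $\epsilon\in I$, $\omega\in\Omega_\epsilon$; (A2) $\|\mathcal L_{\omega,\epsilon}h-\mathcal L_{\omega'}h\|_w\le C\left(d(\omega,\omega')^\zeta+|\epsilon|^\zeta\right)\|h\|_s$ for all $\epsilon\in I$, $h\in\mathcal B_s$, $\omega\in\Omega_\epsilon$, $\omega'\in\Omega_0$; (A3) $\psi(h_{\omega,\epsilon})=1$ and $\|h_{\omega,\epsilon}\|_s\le C$ for all $\epsilon\in I$, $\omega\in\Omega_\epsilon$; (A4) $\mathcal L_{\omega,\epsilon}h_{\omega,\epsilon}=h_{\sigma_\epsilon\omega,\epsilon}$ for all $\epsilon\in I$, $\omega\in\Omega_\epsilon$; (A5) $\sigma^{-1}$ is Lipschitz continuous. In addition, assume that: (B1) there is $K>0$ such that $\sup_j\|\mathcal L_\omega^j\|_s\le K$ for every $\omega\in\Omega_0$ (operator norm on $\mathcal B_s$); (B2) $h_\omega\in\mathcal B_{ss}$ and $\|h_\omega\|_{ss}\le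 C$ for every $\omega\in\Omega_0$; (B3) for every function $\gamma:I\to\Omega$ differentiable at $\epsilon=0$ there exists a bounded operator $\frac{\partial\mathcal L_{\gamma(\epsilon),\epsilon}}{\partial\epsilon}\Big|_{\epsilon=0}:\mathcal B_{ss}\to\mathcal B_s^0$ such that for all $g\in\mathcal B_{ss}$ and $\epsilon\in I$, $$\left\|(\mathcal L_{\gamma(\epsilon),\epsilon}-\mathcal L_{\gamma(0),0})g-\epsilon\left(\frac{\partial\mathcal L_{\gamma(\epsilon),\epsilon}}{\partial\epsilon}\Big|_{\epsilon=0}\right)g\right\|_s\le C\left(|\epsilon|^{1+\zeta}+d(\gamma(\epsilon),\gamma(0))^{1+\zeta}\right)\|g\|_{ss};$$ (B4) the maps $\epsilon\mapsto\sigma_\epsilon^{-k}\omega$ are differentiable at $\epsilon=0$, and $\mathrm{Lip}(\sigma^{-k})\le Ce^{ck}$ for all $k\in\mathbb N$ and some $c<\lambda/(1+\zeta)$; (B5) $\mathrm{dist}_{C^0}(\sigma^{-1},\sigma_\epsilon^{-1})=O(\epsilon)$. Set $$\Lambda_{\omega,j}=\frac{\partial\mathcal L_{\sigma_\epsilon^{-(j+1)}\omega,\epsilon}}{\partial\epsilon}\Big|_{\epsilon=0}$$ and suppose that $\sup_{\omega,j}\|\Lambda_{\omega,j}\|<+\infty$ (norm of operators $\mathcal B_{ss}\to\mathcal B_s$; $\omega\in\Omega$, $j\ge0$). Then for $\omega\in\Omega_0$ the series $$\Gamma_\omega=\sum_{j=0}^\infty\mathcal L_{\sigma^{-j}\omega}^j\Lambda_{\omega,j}h_{\sigma^{-(j+1)}\omega}$$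 converges in the norm $\|\cdot\|_w$, $\sup_{\omega\in\Omega_0}\|\Gamma_\omega\|_w<\infty$, and for every $\omega\in\Omega_\epsilon\cap\Omega_0$, $$\left\|h_{\omega,\epsilon}-h_\omega-\epsilon\Gamma_\omega\right\|_w=O\left(|\ln|\epsilon||\cdot|\epsilon|^{1+\zeta}\right)\quad\text{as }\epsilon\to0,$$ with implied constant independent of $\omega$ and $\epsilon$.
   Context: $\Omega$ is a compact Riemannian manifold with distance $d$, and $I\subset\mathbb R$ is a set containing $0$, with $0$ an accumulation point of $I$. For each $\epsilon\in I$, $\sigma_\epsilon:\Omega\to\Omega$ is a homeomorphism and $\mathbb P_\epsilon$ is a $\sigma_\epsilon$-invariant Borel probability measure on $\Omega$. The map $(\omega,\epsilon)\mapsto\sigma_\epsilon\omega$ is continuous. Write $\sigma=\sigma_0$ and $\mathrm{dist}_{C^0}(\sigma^{-1},\sigma_\epsilon^{-1}):=\max_{y\in\Omega}d(\sigma^{-1}(y),\sigma_\epsilon^{-1}(y))$; $\mathrm{Lip}(\cdot)$ is the Lipschitz constant. $(\mathcal B_w,\|\cdot\|_w)$, $(\mathcal B_s,\|\cdot\|_s)$, $(\mathcal B_{ss},\|\cdot\|_{ss})$ are Banach spaces such that $\mathcal B_{ss}$ is embedded in $\mathcal B_s$, $\mathcal B_s$ is embedded in $\mathcal B_w$, $\|\cdot\|_w\le\|\cdot\|_s$ on $\mathcal B_s$ and $\|\cdot\|_s\le\|\cdot\|_{ss}$ on $\mathcal B_{ss}$. $\psi$ is a non-zero bounded linear functional on $\mathcal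 B_s$ that admits a bounded extension to $\mathcal B_w$ (still denoted $\psi$) and acts as a bounded functional on $\mathcal B_{ss}$. $\mathcal B_s^0:=\{h\in\mathcal B_s:\psi(h)=0\}$. For each $\omega\in\Omega$, $\epsilon\in I$, $\mathcal L_{\omega,\epsilon}$ is a bounded linear operator on both $\mathcal B_s$ and $\mathcal B_w$, and $\psi(\mathcal L_{\omega,\epsilon}h)=\psi(h)$ for all $h\in\mathcal B_w$. For $n\in\mathbb N$, $\mathcal L_{\omega,\epsilon}^n:=\mathcal L_{\sigma_\epsilon^{n-1}\omega,\epsilon}\circ\cdots\circ\mathcal L_{\sigma_\epsilon\omega,\epsilon}\circ\mathcal L_{\omega,\epsilon}$ ($\mathcal L_{\omega,\epsilon}^0=\mathrm{Id}$), $\mathcal L_\omega:=\mathcal L_{\omega,0}$ and $\mathcal L_\omega^j:=\mathcal L_{\omega,0}^j$. *)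

theory Defs
  imports "HOL-Probability.Probability" "HOL-Library.Landau_Symbols"
begin

text \<open>
  Riemannian manifolds without boundary. The points are the elements of a type of class
  \<^class>\<open>metric_space\<close>, whose \<^const>\<open>dist\<close> is the Riemannian distance; the model space is a
  \<^class>\<open>euclidean_space\<close>. A chart is a pair \<open>(U, \<phi>)\<close> of an open set and a map whose values
  matter on \<open>U\<close> only.
\<close>

primrec Ck_on :: "nat \<Rightarrow> 'a::euclidean_space set \<Rightarrow> ('a \<Rightarrow> 'b::real_normed_vector) \<Rightarrow> bool"
  where
    "Ck_on 0 S f \<longleftrightarrow> continuous_on S f"
  | "Ck_on (Suc k) S f \<longleftrightarrow>
       (\<forall>x\<in>S. f differentiable (at x)) \<and> (\<forall>v. Ck_on k S (\<lambda>x. frechet_derivative f (at x) v))"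

definition smooth_on :: "'a::euclidean_space set \<Rightarrow> ('a \<Rightarrow> 'b::real_normed_vector) \<Rightarrow> bool"
  where "smooth_on S f \<longleftrightarrow> (\<forall>k. Ck_on k S f)"

type_synonym ('m, 'e) chart = "'m set \<times> ('m \<Rightarrow> 'e)"

definition is_chart :: "('m::metric_space, 'e::euclidean_space) chart \<Rightarrow> bool"
  where "is_chart = (\<lambda>(U, \<phi>). open U \<and> open (\<phi> ` U) \<and> homeomorphism U (\<phi> ` U) \<phi> (inv_into U \<phi>))"

definition smooth_atlas :: "('m::metric_space, 'e::euclidean_space) chart set \<Rightarrow> bool"
  where "smooth_atlas A \<longleftrightarrow>
    (\<forall>c\<in>A. is_chart c) \<and> (\<Union>(U, \<phi>)\<in>A. U) = UNIV \<and>
    (\<forall>(U, \<phi>)\<in>A. \<forall>(V, \<theta>)\<in>A. smooth_on (\<phi> ` (U \<inter> V)) (\<theta> \<circ> inv_into U \<phi>))"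

text \<open>
  A metric tensor is given by its local expressions: \<open>G (U, \<phi>) p u v\<close> is the inner product of
  the tangent vectors at \<open>p \<in> U\<close> that have coordinates \<open>u\<close> and \<open>v\<close> in the chart \<open>(U, \<phi>)\<close>.
\<close>

type_synonym ('m, 'e) metric_tensor = "('m, 'e) chart \<Rightarrow> 'm \<Rightarrow> 'e \<Rightarrow> 'e \<Rightarrow> real"

definition riemannian_metric ::
    "('m::metric_space, 'e::euclidean_space) chart set \<Rightarrow> ('m, 'e) metric_tensor \<Rightarrow> bool"
  where "riemannian_metric A G \<longleftrightarrow>
    (\<forall>(U, \<phi>)\<in>A.
      (\<forall>p\<in>U. bilinear (G (U, \<phi>) p) \<and> (\<forall>u v. G (U, \<phi>) p u v = G (U, \<phi>) p v u) \<and>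
              (\<forall>u. u \<noteq> 0 \<longrightarrow> G (U, \<phi>) p u u > 0)) \<and>
      (\<forall>u v. smooth_on (\<phi> ` U) (\<lambda>x. G (U, \<phi>) (inv_into U \<phi> x) u v)) \<and>
      (\<forall>(V, \<theta>)\<in>A. \<forall>p\<in>U \<inter> V. \<forall>u v.
         G (U, \<phi>) p u v =
         G (V, \<theta>) p (frechet_derivative (\<theta> \<circ> inv_into U \<phi>) (at (\<phi> p)) u)
                    (frechet_derivative (\<theta> \<circ> inv_into U \<phi>) (at (\<phi> p)) v)))"

text \<open>
  \<open>curve_length A G x y l\<close>: some piecewise \<open>C\<^sup>1\<close> curve from \<open>x\<close> to \<open>y\<close> has length \<open>l\<close>. By
  compactness of the parameter interval, piecewise \<open>C\<^sup>1\<close> curves are exactly the concatenations of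
  finitely many \<open>C\<^sup>1\<close> arcs each of which lies in one chart domain.
\<close>

inductive curve_length ::
    "('m::metric_space, 'e::euclidean_space) chart set \<Rightarrow> ('m, 'e) metric_tensor \<Rightarrow>
     'm \<Rightarrow> 'm \<Rightarrow> real \<Rightarrow> bool"
  for A :: "('m, 'e) chart set" and G :: "('m, 'e) metric_tensor"
  where
    const: "curve_length A G x x 0"
  | arc: "\<lbrakk>curve_length A G x (\<gamma> a) l; (U, \<phi>) \<in> A; a \<le> b; \<gamma> ` {a..b} \<subseteq> U;
      \<forall>t\<in>{a..b}. ((\<phi> \<circ> \<gamma>) has_vector_derivative v t) (at t within {a..b});
      continuous_on {a..b} v\<rbrakk> \<Longrightarrow>
      curve_length A G x (\<gamma> b) (l + integral {a..b} (\<lambda>t. sqrt (G (U, \<phi>) (\<gamma> t) (v t) (v t))))"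

text \<open>
  Points that are joined by a curve have the Riemannian distance. On a connected manifold this
  determines \<^const>\<open>dist\<close>; between different components, where there is no curve and no canonical
  choice, \<^const>\<open>dist\<close> is an arbitrary metric inducing the manifold topology.
\<close>

definition riemannian_manifold ::
    "('m::metric_space, 'e::euclidean_space) chart set \<Rightarrow> ('m, 'e) metric_tensor \<Rightarrow> bool"
  where "riemannian_manifold A G \<longleftrightarrow> smooth_atlas A \<and> riemannian_metric A G \<and>
    (\<forall>x y. (\<exists>l. curve_length A G x y l) \<longrightarrow> dist x y = Inf {l. curve_length A G x y l})"

text \<open>
  Differentiability at \<open>t\<close> of a map \<open>\<gamma> : I \<rightarrow> M\<close>, where \<open>t\<close> is an accumulation point of \<open>I\<close>.
  For a smooth atlas the choice of the chart around \<open>\<gamma> t\<close> is irrelevant. Continuity makes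
  \<open>\<phi> \<circ> \<gamma>\<close> meaningful near \<open>t\<close>.
\<close>

definition mfd_differentiable ::
    "('m::metric_space, 'e::euclidean_space) chart set \<Rightarrow> real set \<Rightarrow> (real \<Rightarrow> 'm) \<Rightarrow> real \<Rightarrow> bool"
  where "mfd_differentiable A I \<gamma> t \<longleftrightarrow> continuous (at t within I) \<gamma> \<and>
    (\<exists>(U, \<phi>)\<in>A. \<gamma> t \<in> U \<and> (\<phi> \<circ> \<gamma>) differentiable (at t within I))"

text \<open>\<open>cocycle T L n \<omega> = L (T\<^sup>n\<^sup>-\<^sup>1 \<omega>) \<circ> \<dots> \<circ> L (T \<omega>) \<circ> L \<omega>\<close>\<close>

primrec cocycle ::
    "('m \<Rightarrow> 'm) \<Rightarrow> ('m \<Rightarrow> 'b::real_normed_vector \<Rightarrow>\<^sub>L 'b) \<Rightarrow> nat \<Rightarrow> 'm \<Rightarrow> 'b \<Rightarrow>\<^sub>L 'b"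
  where
    "cocycle T L 0 \<omega> = id_blinfun"
  | "cocycle T L (Suc n) \<omega> = L ((T ^^ n) \<omega>) o\<^sub>L cocycle T L n \<omega>"

definition dist_C0 :: "('m::metric_space \<Rightarrow> 'm) \<Rightarrow> ('m \<Rightarrow> 'm) \<Rightarrow> real"
  where "dist_C0 f g = (SUP y. dist (f y) (g y))"

text \<open>
  \<open>is_param_derivative I L j Z C \<zeta> \<gamma> D\<close>: the operator \<open>D\<close> from the strongest space \<open>'ss\<close> into the
  subspace \<open>Z\<close> of \<open>'s\<close> is the derivative at \<open>\<epsilon> = 0\<close> of \<open>\<epsilon> \<mapsto> L (\<gamma> \<epsilon>) \<epsilon>\<close>, with the quantitative
  remainder estimate; \<open>j\<close> embeds \<open>'ss\<close> into \<open>'s\<close>. If \<open>0\<close> is an accumulation point of \<open>I\<close> and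
  \<open>\<gamma>\<close> is differentiable at \<open>0\<close>, the estimate determines \<open>D\<close> uniquely.
\<close>

definition is_param_derivative ::
    "real set \<Rightarrow> ('m::metric_space \<Rightarrow> real \<Rightarrow> 's::real_normed_vector \<Rightarrow>\<^sub>L 's) \<Rightarrow>
     ('ss::real_normed_vector \<Rightarrow>\<^sub>L 's) \<Rightarrow> 's set \<Rightarrow> real \<Rightarrow> real \<Rightarrow> (real \<Rightarrow> 'm) \<Rightarrow> ('ss \<Rightarrow>\<^sub>L 's) \<Rightarrow> bool"
  where "is_param_derivative I L j Z C \<zeta> \<gamma> D \<longleftrightarrow> range D \<subseteq> Z \<and>
    (\<forall>g. \<forall>\<epsilon>\<in>I. norm ((L (\<gamma> \<epsilon>) \<epsilon> - L (\<gamma> 0) 0) (j g) - \<epsilon> *\<^sub>R D g)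
       \<le> C * (\<bar>\<epsilon>\<bar> powr (1 + \<zeta>) + dist (\<gamma> \<epsilon>) (\<gamma> 0) powr (1 + \<zeta>)) * norm g)"

end

theory Submission
  imports Defs
begin

text \<open>
  Writing \<open>\<tau>\<^sub>\<epsilon> = \<sigma>\<^sub>\<epsilon>\<^sup>-\<^sup>1\<close>, equivariance telescopes \<open>h\<^sub>\<omega>\<^sub>,\<^sub>\<epsilon> - h\<^sub>\<omega>\<close> along the two backward orbits of \<open>\<omega>\<close>
  into \<open>\<L>\<^sup>n\<^sub>\<epsilon> (h\<^sub>\<epsilon> - h)(n) + \<Sum>\<^sub>j\<^sub><\<^sub>n \<L>\<^sup>j\<^sub>\<epsilon> (\<epsilon> \<Lambda>\<^sub>j h + R\<^sub>j)\<close>. The orbits separate at most like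
  \<open>e\<^sup>c\<^sup>j \<bar>\<epsilon>\<bar>\<close>, so the condition \<open>c (1 + \<zeta>) < \<lambda>\<close> lets the decay (A1) beat the remainders \<open>R\<^sub>j\<close>.
  Replacing \<open>\<L>\<^sup>j\<^sub>\<epsilon>\<close> by \<open>\<L>\<^sup>j\<close>, by a second telescoping, costs \<open>O(\<bar>\<epsilon>\<bar>\<^sup>\<zeta>)\<close> uniformly in \<open>j\<close>, hence
  \<open>O(n \<bar>\<epsilon>\<bar>\<^sup>1\<^sup>+\<^sup>\<zeta>)\<close> in total, and the logarithm comes from the choice
  \<open>n \<approx> (1 + \<zeta>) \<bar>ln \<bar>\<epsilon>\<bar>\<bar> / \<lambda>\<close>, for which \<open>e\<^sup>-\<^sup>\<lambda>\<^sup>n \<le> \<bar>\<epsilon>\<bar>\<^sup>1\<^sup>+\<^sup>\<zeta>\<close>.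
\<close>

section \<open>Cocycles along backward orbits\<close>

lemma funpow_right_inverse:
  assumes "\<And>x. T (S x) = x"
  shows "(T ^^ m) ((S ^^ (m + k)) x) = (S ^^ k) x"
proof (induction m)
  case (Suc m)
  have "(T ^^ Suc m) ((S ^^ (Suc m + k)) x) = (T ^^ m) (T (S ((S ^^ (m + k)) x)))"
    by (simp add: funpow_swap1)
  then show ?case using Suc assms by simp
qed simp

text \<open>The recursion adds factors at the end of the orbit. Telescoping along backward orbits
  keeps the endpoint fixed and moves the starting point back, so the first factor has to be split
  off instead.\<close>

lemma cocycle_Suc_right:
  "cocycle T L (Suc n) \<omega> = cocycle T L n (T \<omega>) o\<^sub>L L \<omega>"
proof (induction n)
  case (Suc n)
  have "cocycle T L (Suc (Suc n)) \<omega> = L ((T ^^ Suc n) \<omega>) o\<^sub>L (cocycle T L n (T \<omega>) o\<^sub>L L \<omega>)"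
    using Suc by simp
  also have "\<dots> = cocycle T L (Suc n) (T \<omega>) o\<^sub>L L \<omega>"
    by (rule blinfun_eqI) (simp add: funpow_swap1)
  finally show ?case .
qed (rule blinfun_eqI, simp)

lemma cocycle_intertwine:
  fixes j :: "'a::real_normed_vector \<Rightarrow>\<^sub>L 'b::real_normed_vector"
    and L :: "'m \<Rightarrow> 'b \<Rightarrow>\<^sub>L 'b" and L' :: "'m \<Rightarrow> 'a \<Rightarrow>\<^sub>L 'a"
  assumes "\<And>\<omega> f. L \<omega> (j f) = j (L' \<omega> f)"
  shows "cocycle T L n \<omega> (j f) = j (cocycle T L' n \<omega> f)"
  by (induction n) (simp_all add: assms)

text \<open>A discrete Duhamel formula: substituting \<open>step\<close> into itself carries the
  error \<open>r k\<close> forward by the k steps that lead from \<open>(S ^^ k) x\<close> back to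
  \<open>x\<close>. For this it is enough that \<open>S\<close> selects preimages under
  \<open>T\<close>.\<close>

lemma cocycle_telescope:
  fixes L :: "'m \<Rightarrow> 'b::real_normed_vector \<Rightarrow>\<^sub>L 'b"
  assumes TS: "\<And>x. T (S x) = x"
    and step: "\<And>k. k < n \<Longrightarrow> u k = L ((S ^^ Suc k) x) (u (Suc k)) + r k"
  shows "u 0 = cocycle T L n ((S ^^ n) x) (u n) + (\<Sum>k<n. cocycle T L k ((S ^^ k) x) (r k))"
  using step
proof (induction n)
  case (Suc n)
  have "cocycle T L n ((S ^^ n) x) (u n) =
      cocycle T L (Suc n) ((S ^^ Suc n) x) (u (Suc n)) + cocycle T L n ((S ^^ n) x) (r n)"
    unfolding cocycle_Suc_right using Suc.prems[of n]
    by (simp add: blinfun.add_right TS)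
  with Suc show ?case by simp
qed simp

text \<open>The interpolant \<open>u i\<close> below is the primed product stopped i steps before
  \<open>x\<close>; telescoping it with the unprimed operators leaves one operator difference per
  summand. The unprimed cocycle ends up outside, where decay is available, and the primed one
  inside, where only boundedness will be known.\<close>

lemma cocycle_diff:
  fixes L L' :: "'m \<Rightarrow> 'b::real_normed_vector \<Rightarrow>\<^sub>L 'b"
  assumes TS: "\<And>x. T (S x) = x" and TS': "\<And>x. T' (S' x) = x"
  shows "cocycle T L n ((S ^^ n) x) g - cocycle T' L' n ((S' ^^ n) x) g =
    (\<Sum>i<n. cocycle T L i ((S ^^ i) x)
      ((L ((S ^^ Suc i) x) - L' ((S' ^^ Suc i) x)) (cocycle T' L' (n - Suc i) ((S' ^^ n) x) g)))"
proof -
  define u where "u i = cocycle T' L' (n - i) ((S' ^^ n) x) g" for i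
  define r where "r i = (L' ((S' ^^ Suc i) x) - L ((S ^^ Suc i) x)) (u (Suc i))" for i
  have "u i = L ((S ^^ Suc i) x) (u (Suc i)) + r i" if "i < n" for i
  proof -
    have n: "n - i = Suc (n - Suc i)" "n = (n - Suc i) + Suc i" using that by auto
    have "(T' ^^ (n - Suc i)) ((S' ^^ n) x) = (S' ^^ Suc i) x"
      using funpow_right_inverse[of T' S' "n - Suc i" "Suc i" x] TS' n(2) by simp
    then have "u i = L' ((S' ^^ Suc i) x) (u (Suc i))"
      unfolding u_def n(1) by simp
    then show ?thesis by (simp add: r_def blinfun.diff_left)
  qed
  from cocycle_telescope[of T S n u L x r, OF TS this]
  have "u 0 = cocycle T L n ((S ^^ n) x) (u n) + (\<Sum>i<n. cocycle T L i ((S ^^ i) x) (r i))" .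
  moreover have "r i = - ((L ((S ^^ Suc i) x) - L' ((S' ^^ Suc i) x)) (u (Suc i)))" for i
    by (simp add: r_def blinfun.diff_left)
  ultimately show ?thesis
    by (simp add: u_def blinfun.minus_right sum_negf)
qed

section \<open>Orbit separation and exponential sums\<close>

lemma dist_funpow_le:
  fixes f g :: "'a::metric_space \<Rightarrow> 'a"
  assumes lip: "\<And>k. (l k)-lipschitz_on UNIV (g ^^ k)"
    and close: "\<And>y. dist (f y) (g y) \<le> \<delta>"
  shows "dist ((f ^^ k) x) ((g ^^ k) x) \<le> (\<Sum>i<k. l i) * \<delta>"
proof (induction k arbitrary: x)
  case (Suc k)
  \<comment> \<open>The induction hypothesis is taken at \<open>f x\<close>, and the discrepancy of
    the first step is transported by \<open>g ^^ k\<close>. So the constants of the iterates enter,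
    not powers of a one-step constant.\<close>
  have "dist ((f ^^ Suc k) x) ((g ^^ Suc k) x) \<le>
      dist ((f ^^ k) (f x)) ((g ^^ k) (f x)) + dist ((g ^^ k) (f x)) ((g ^^ k) (g x))"
    by (simp add: funpow_Suc_right dist_triangle del: funpow.simps)
  also have "\<dots> \<le> (\<Sum>i<k. l i) * \<delta> + l k * dist (f x) (g x)"
    by (intro add_mono Suc lipschitz_onD[OF lip]) auto
  also have "\<dots> \<le> (\<Sum>i<k. l i) * \<delta> + l k * \<delta>"
    by (intro add_left_mono mult_left_mono close lipschitz_on_nonneg[OF lip])
  finally show ?case by (simp add: algebra_simps)
qed simp

lemma sum_exp_increasing_le:
  fixes c :: real
  assumes "c > 0"
  shows "(\<Sum>i<k. exp (c * real i)) \<le> exp (c * real k) / (exp c - 1)"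
proof (induction k)
  case (Suc k)
  have "exp c - 1 > 0" using assms by simp
  then have "exp (c * real k) / (exp c - 1) + exp (c * real k) = exp (c * real (Suc k)) / (exp c - 1)"
    by (simp add: field_simps exp_add)
  with Suc show ?case by simp
qed (use assms in simp)

lemma exp_decay_eq_power: "exp (- (a * real j)) = exp (- a :: real) ^ j"
  by (simp add: exp_of_nat_mult[symmetric] mult.commute)

lemma sum_exp_decay_le:
  fixes a :: real
  assumes "a > 0"
  shows "(\<Sum>j<n. exp (- a * real j)) \<le> 1 / (1 - exp (- a))"
proof -
  have "norm (exp (- a)) < 1" using assms by simp
  from geometric_sums[OF this] have "(\<lambda>j. exp (- a * real j)) sums (1 / (1 - exp (- a)))"
    by (simp add: exp_decay_eq_power)
  from sum_le_suminf[OF sums_summable[OF this], of "{..<n}"] sums_unique[OF this]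
  show ?thesis by simp
qed

lemma exp_decay_tail_bound:
  fixes v :: "nat \<Rightarrow> 'a::banach"
  assumes a: "a > 0" and v: "\<And>j. norm (v j) \<le> B * exp (- a * real j)"
  shows "summable v"
    and "norm (suminf v - (\<Sum>j<n. v j)) \<le> B * exp (- a * real n) / (1 - exp (- a))"
proof -
  have g: "norm (exp (- a)) < 1" using a by simp
  \<comment> \<open>The comparison series already carries the shift: n = 0 yields summability,
    general n the tail estimate.\<close>
  have sums: "(\<lambda>j. B * exp (- a * real n) * exp (- a) ^ j) sums
      (B * exp (- a * real n) * (1 / (1 - exp (- a))))" for n
    by (intro sums_mult geometric_sums g)
  have le: "norm (v (j + n)) \<le> B * exp (- a * real n) * exp (- a) ^ j" for j n
    using v[of "j + n"] exp_decay_eq_power[of a "j + n"]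
    by (simp add: exp_decay_eq_power power_add mult_ac del: of_nat_add)
  show s: "summable v"
    using summable_comparison_test'[OF sums_summable[OF sums[of 0]], of 0 v] le[of _ 0] by simp
  have "norm (\<Sum>j. v (j + n)) \<le> (\<Sum>j. B * exp (- a * real n) * exp (- a) ^ j)"
    by (intro norm_suminf_le le sums_summable[OF sums])
  then show "norm (suminf v - (\<Sum>j<n. v j)) \<le> B * exp (- a * real n) / (1 - exp (- a))"
    using suminf_split_initial_segment[OF s, of n] sums_unique[OF sums, of n] by simp
qed

text \<open>The power \<open>d (Suc j) powr p\<close> grows at rate at most \<open>c * p\<close>,
  which the decay rate \<open>a\<close> exceeds; both parts are then geometric and the bound is
  uniform in n. The factor \<open>exp (c * p)\<close> pays for the index shift. The exponent p will
  be \<open>1 + \<zeta>\<close> for derivative remainders and \<open>\<zeta>\<close> for the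
  exchange of cocycles.\<close>

lemma weighted_separation_sum_le:
  fixes a c e N p :: real and d :: "nat \<Rightarrow> real"
  assumes "a > 0" "p > 0" "c * p < a" "N \<ge> 0" "e \<ge> 0"
    and d: "\<And>k. 0 \<le> d k" "\<And>k. d k \<le> N * exp (c * real k) * e"
  shows "(\<Sum>j<n. exp (- a * real j) * (d (Suc j) powr p + e powr p)) \<le>
    (N powr p * exp (c * p) / (1 - exp (- (a - c * p))) + 1 / (1 - exp (- a))) * e powr p"
proof -
  have "exp (- a * real j) * (d (Suc j) powr p + e powr p) \<le>
      N powr p * exp (c * p) * e powr p * exp (- (a - c * p) * real j) +
      e powr p * exp (- a * real j)" for j
  proof -
    have "d (Suc j) powr p \<le> (N * exp (c * real (Suc j)) * e) powr p"
      using assms(2) d by (intro powr_mono2) (simp_all del: of_nat_Suc)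
    also have "\<dots> = N powr p * exp (c * p) * exp (c * p * real j) * e powr p"
      using assms by (simp add: powr_mult exp_powr_real algebra_simps flip: exp_add)
    finally have "exp (- a * real j) * d (Suc j) powr p \<le>
        exp (- a * real j) * (N powr p * exp (c * p) * exp (c * p * real j) * e powr p)"
      by simp
    also have "\<dots> = N powr p * exp (c * p) * e powr p * exp (- (a - c * p) * real j)"
      by (simp add: algebra_simps flip: exp_add)
    finally show ?thesis by (simp add: algebra_simps)
  qed
  then have "(\<Sum>j<n. exp (- a * real j) * (d (Suc j) powr p + e powr p)) \<le>
      N powr p * exp (c * p) * e powr p * (\<Sum>j<n. exp (- (a - c * p) * real j)) +
      e powr p * (\<Sum>j<n. exp (- a * real j))"
    unfolding sum_distrib_left sum.distrib[symmetric] by (intro sum_mono)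
  also have "\<dots> \<le> N powr p * exp (c * p) * e powr p * (1 / (1 - exp (- (a - c * p)))) +
      e powr p * (1 / (1 - exp (- a)))"
    using assms by (intro add_mono mult_left_mono sum_exp_decay_le) auto
  also have "\<dots> = (N powr p * exp (c * p) / (1 - exp (- (a - c * p))) + 1 / (1 - exp (- a))) * e powr p"
    by (simp add: algebra_simps)
  finally show ?thesis .
qed

text \<open>A real supremum is an upper bound only if the set is bounded above, which boundedness of
  the space ensures.\<close>

lemma dist_le_dist_C0:
  fixes f g :: "'m::metric_space \<Rightarrow> 'm"
  assumes "bounded (UNIV :: 'm set)"
  shows "dist (f y) (g y) \<le> dist_C0 f g"
proof -
  obtain b where "\<And>x y :: 'm. dist x y \<le> b"
    using assms unfolding bounded_two_points by auto
  then have "bdd_above (range (\<lambda>y. dist (f y) (g y)))"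
    by (intro bdd_aboveI2)
  then show ?thesis unfolding dist_C0_def by (intro cSUP_upper) auto
qed

theorem theorem3:
  fixes A :: "('m::metric_space, 'e::euclidean_space) chart set"
    and G :: "('m, 'e) metric_tensor"
    and I :: "real set"
    and \<sigma> :: "real \<Rightarrow> 'm \<Rightarrow> 'm"
    and P :: "real \<Rightarrow> 'm measure"
    and j\<^sub>s :: "'s::banach \<Rightarrow>\<^sub>L 'w::banach"
    and j\<^sub>s\<^sub>s :: "'ss::banach \<Rightarrow>\<^sub>L 's"
    \<comment> \<open>the field \<open>'k\<close> is \<open>real\<close> for real and \<open>complex\<close> for complex Banach spaces;
        in the complex case only real-linearity of the maps is needed\<close>
    and \<psi> :: "'w \<Rightarrow>\<^sub>L 'k::real_normed_field"
    and L\<^sub>w :: "'m \<Rightarrow> real \<Rightarrow> 'w \<Rightarrow>\<^sub>L 'w"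
    and L\<^sub>s :: "'m \<Rightarrow> real \<Rightarrow> 's \<Rightarrow>\<^sub>L 's"
    and C rate \<zeta> K c :: real
    and \<Omega> :: "real \<Rightarrow> 'm set"
    and h :: "'m \<Rightarrow> real \<Rightarrow> 's"
    and h\<^sub>s\<^sub>s :: "'m \<Rightarrow> 'ss"
    and \<Lambda> :: "'m \<Rightarrow> nat \<Rightarrow> 'ss \<Rightarrow>\<^sub>L 's"
  assumes manifold: "compact (UNIV :: 'm set)" "riemannian_manifold A G"
    and I: "0 \<in> I" "0 islimpt I"
    and homeo: "\<And>\<epsilon>. \<epsilon> \<in> I \<Longrightarrow> homeomorphism UNIV UNIV (\<sigma> \<epsilon>) (inv (\<sigma> \<epsilon>))"
    and cont: "continuous_on (UNIV \<times> I) (\<lambda>(\<omega>, \<epsilon>). \<sigma> \<epsilon> \<omega>)"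
    and prob: "\<And>\<epsilon>. \<epsilon> \<in> I \<Longrightarrow> prob_space (P \<epsilon>)" "\<And>\<epsilon>. \<epsilon> \<in> I \<Longrightarrow> sets (P \<epsilon>) = sets borel"
    and invariant: "\<And>\<epsilon>. \<epsilon> \<in> I \<Longrightarrow> distr (P \<epsilon>) (P \<epsilon>) (\<sigma> \<epsilon>) = P \<epsilon>"
    and embed: "inj j\<^sub>s" "\<And>f. norm (j\<^sub>s f) \<le> norm f" "inj j\<^sub>s\<^sub>s" "\<And>g. norm (j\<^sub>s\<^sub>s g) \<le> norm g"
    and \<psi>_nonzero: "\<exists>f. \<psi> (j\<^sub>s f) \<noteq> 0"
    and L_restrict: "\<And>\<omega> \<epsilon> f. \<epsilon> \<in> I \<Longrightarrow> L\<^sub>w \<omega> \<epsilon> (j\<^sub>s f) = j\<^sub>s (L\<^sub>s \<omega> \<epsilon> f)"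
    and \<psi>_L: "\<And>\<omega> \<epsilon> f. \<epsilon> \<in> I \<Longrightarrow> \<psi> (L\<^sub>w \<omega> \<epsilon> f) = \<psi> f"
    and constants: "C > 0" "rate > 0" "0 < \<zeta>" "\<zeta> \<le> 1"
    and \<Omega>: "\<And>\<epsilon>. \<epsilon> \<in> I \<Longrightarrow> \<Omega> \<epsilon> \<in> sets borel" "\<And>\<epsilon>. \<epsilon> \<in> I \<Longrightarrow> \<sigma> \<epsilon> -` \<Omega> \<epsilon> = \<Omega> \<epsilon>"
      "\<And>\<epsilon>. \<epsilon> \<in> I \<Longrightarrow> measure (P \<epsilon>) (\<Omega> \<epsilon>) = 1"
    and A1: "\<And>f n \<epsilon> \<omega>. \<psi> f = 0 \<Longrightarrow> \<epsilon> \<in> I \<Longrightarrow> \<omega> \<in> \<Omega> \<epsilon> \<Longrightarrow>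
      norm (cocycle (\<sigma> \<epsilon>) (\<lambda>\<omega>. L\<^sub>w \<omega> \<epsilon>) n \<omega> f) \<le> C * exp (- rate * real n) * norm f"
    and A2: "\<And>\<epsilon> f \<omega> \<omega>'. \<epsilon> \<in> I \<Longrightarrow> \<omega> \<in> \<Omega> \<epsilon> \<Longrightarrow> \<omega>' \<in> \<Omega> 0 \<Longrightarrow>
      norm (L\<^sub>w \<omega> \<epsilon> (j\<^sub>s f) - L\<^sub>w \<omega>' 0 (j\<^sub>s f)) \<le> C * (dist \<omega> \<omega>' powr \<zeta> + \<bar>\<epsilon>\<bar> powr \<zeta>) * norm f"
    and A3: "\<And>\<epsilon> \<omega>. \<epsilon> \<in> I \<Longrightarrow> \<omega> \<in> \<Omega> \<epsilon> \<Longrightarrow> \<psi> (j\<^sub>s (h \<omega> \<epsilon>)) = 1 \<and> norm (h \<omega> \<epsilon>) \<le> C"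
    and A4: "\<And>\<epsilon> \<omega>. \<epsilon> \<in> I \<Longrightarrow> \<omega> \<in> \<Omega> \<epsilon> \<Longrightarrow> L\<^sub>s \<omega> \<epsilon> (h \<omega> \<epsilon>) = h (\<sigma> \<epsilon> \<omega>) \<epsilon>"
    and A5: "\<exists>M. M-lipschitz_on UNIV (inv (\<sigma> 0))"
    and B1: "K > 0" "\<And>\<omega> j. \<omega> \<in> \<Omega> 0 \<Longrightarrow> norm (cocycle (\<sigma> 0) (\<lambda>\<omega>. L\<^sub>s \<omega> 0) j \<omega>) \<le> K"
    and B2: "\<And>\<omega>. \<omega> \<in> \<Omega> 0 \<Longrightarrow> h \<omega> 0 = j\<^sub>s\<^sub>s (h\<^sub>s\<^sub>s \<omega>) \<and> norm (h\<^sub>s\<^sub>s \<omega>) \<le> C"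
    and B3: "\<And>\<gamma>. mfd_differentiable A I \<gamma> 0 \<Longrightarrow>
      \<exists>D. is_param_derivative I L\<^sub>s j\<^sub>s\<^sub>s {f. \<psi> (j\<^sub>s f) = 0} C \<zeta> \<gamma> D"
    and B4: "\<And>k \<omega>. mfd_differentiable A I (\<lambda>\<epsilon>. (inv (\<sigma> \<epsilon>) ^^ k) \<omega>) 0"
      "\<And>k. (C * exp (c * real k))-lipschitz_on UNIV (inv (\<sigma> 0) ^^ k)" "c < rate / (1 + \<zeta>)"
    and B5: "(\<lambda>\<epsilon>. dist_C0 (inv (\<sigma> 0)) (inv (\<sigma> \<epsilon>))) \<in> O[at 0 within I](\<lambda>\<epsilon>. \<epsilon>)"
    and \<Lambda>: "\<And>\<omega> j. is_param_derivative I L\<^sub>s j\<^sub>s\<^sub>s {f. \<psi> (j\<^sub>s f) = 0} C \<zeta>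
      (\<lambda>\<epsilon>. (inv (\<sigma> \<epsilon>) ^^ (j + 1)) \<omega>) (\<Lambda> \<omega> j)"
    and \<Lambda>_bounded: "\<exists>M. \<forall>\<omega> j. norm (\<Lambda> \<omega> j) \<le> M"
  shows "\<exists>\<Gamma> :: 'm \<Rightarrow> 'w.
    (\<forall>\<omega>\<in>\<Omega> 0. (\<lambda>j. j\<^sub>s (cocycle (\<sigma> 0) (\<lambda>\<omega>. L\<^sub>s \<omega> 0) j ((inv (\<sigma> 0) ^^ j) \<omega>)
        (\<Lambda> \<omega> j (h\<^sub>s\<^sub>s ((inv (\<sigma> 0) ^^ (j + 1)) \<omega>))))) sums \<Gamma> \<omega>) \<and>
    (\<exists>M. \<forall>\<omega>\<in>\<Omega> 0. norm (\<Gamma> \<omega>) \<le> M) \<and>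
    (\<exists>M. \<forall>\<^sub>F \<epsilon> in at 0 within I. \<forall>\<omega>\<in>\<Omega> \<epsilon> \<inter> \<Omega> 0.
        norm (j\<^sub>s (h \<omega> \<epsilon>) - j\<^sub>s (h \<omega> 0) - \<epsilon> *\<^sub>R \<Gamma> \<omega>) \<le> M * (\<bar>ln \<bar>\<epsilon>\<bar>\<bar> * \<bar>\<epsilon>\<bar> powr (1 + \<zeta>)))"
proof -

  \<comment> \<open>Inverse dynamics and decay along backward orbits\<close>
  define \<tau> where "\<tau> \<epsilon> = inv (\<sigma> \<epsilon>)" for \<epsilon>
  define Lcs where "Lcs = cocycle (\<sigma> 0) (\<lambda>\<omega>. L\<^sub>s \<omega> 0)"
  define Lcw where "Lcw \<epsilon> = cocycle (\<sigma> \<epsilon>) (\<lambda>\<omega>. L\<^sub>w \<omega> \<epsilon>)" for \<epsilon>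
  have \<sigma>\<tau>: "\<sigma> \<epsilon> (\<tau> \<epsilon> x) = x" if "\<epsilon> \<in> I" for \<epsilon> x
    using homeo[OF that] by (auto simp: homeomorphism_def \<tau>_def)
  have \<tau>_\<Omega>: "(\<tau> \<epsilon> ^^ k) x \<in> \<Omega> \<epsilon>" if "\<epsilon> \<in> I" "x \<in> \<Omega> \<epsilon>" for \<epsilon> k x
  proof (induction k)
    case (Suc k)
    then show ?case using \<Omega>(2)[OF that(1)] \<sigma>\<tau>[OF that(1)] by force
  qed (use that in simp)
  have Lcw_js: "Lcw 0 n x (j\<^sub>s f) = j\<^sub>s (Lcs n x f)" for n x f
    unfolding Lcw_def Lcs_def by (rule cocycle_intertwine) (rule L_restrict[OF I(1)])
  have Lcw_decay: "norm (Lcw \<epsilon> n ((\<tau> \<epsilon> ^^ k) x) f) \<le> C * exp (- rate * real n) * B"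
    if "\<epsilon> \<in> I" "x \<in> \<Omega> \<epsilon>" "\<psi> f = 0" "norm f \<le> B" for \<epsilon> n k x f B
  proof -
    have "norm (Lcw \<epsilon> n ((\<tau> \<epsilon> ^^ k) x) f) \<le> C * exp (- rate * real n) * norm f"
      unfolding Lcw_def by (intro A1 \<tau>_\<Omega> that)
    also have "\<dots> \<le> C * exp (- rate * real n) * B"
      using constants that by (intro mult_left_mono) auto
    finally show ?thesis .
  qed

  \<comment> \<open>Convergence of the response series\<close>
  obtain M0 where M0: "\<And>\<omega> j. norm (\<Lambda> \<omega> j) \<le> M0" using \<Lambda>_bounded by auto
  have M0_nonneg: "M0 \<ge> 0" using M0 norm_ge_zero order_trans by blast
  define q where "q \<omega> j = \<Lambda> \<omega> j (h\<^sub>s\<^sub>s ((\<tau> 0 ^^ Suc j) \<omega>))" for \<omega> j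
  \<comment> \<open>The derivative takes values in the kernel of \<psi>, which is what makes (A1)
    applicable to each term of the series.\<close>
  have \<psi>_\<Lambda>: "\<psi> (j\<^sub>s (\<Lambda> \<omega> j g)) = 0" for \<omega> j g
    using \<Lambda>[of j \<omega>] unfolding is_param_derivative_def by auto
  have q: "\<psi> (j\<^sub>s (q \<omega> j)) = 0" for \<omega> j
    by (simp add: q_def \<psi>_\<Lambda>)
  have q_norm: "norm (q \<omega> j) \<le> M0 * C" if "\<omega> \<in> \<Omega> 0" for \<omega> j
  proof -
    have "norm (q \<omega> j) \<le> norm (\<Lambda> \<omega> j) * norm (h\<^sub>s\<^sub>s ((\<tau> 0 ^^ Suc j) \<omega>))"
      unfolding q_def by (rule norm_blinfun)
    also have "\<dots> \<le> M0 * C"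
      using B2[OF \<tau>_\<Omega>[OF I(1) that, of "Suc j"]] M0 M0_nonneg by (intro mult_mono) auto
    finally show ?thesis .
  qed
  \<comment> \<open>The terms are written with the weak cocycle, since (A1) gives decay in the weak
    norm only; \<open>Lcw_js\<close> identifies them with the terms of the claim.\<close>
  define v where "v \<omega> j = Lcw 0 j ((\<tau> 0 ^^ j) \<omega>) (j\<^sub>s (q \<omega> j))" for \<omega> j
  have v: "norm (v \<omega> j) \<le> C * (M0 * C) * exp (- rate * real j)" if "\<omega> \<in> \<Omega> 0" for \<omega> j
    using Lcw_decay[OF I(1) that q order_trans[OF embed(2) q_norm[OF that]]]
    by (simp add: v_def mult_ac)
  define \<Gamma> where "\<Gamma> \<omega> = suminf (v \<omega>)" for \<omega>
  define F where "F = C * (M0 * C) / (1 - exp (- rate))"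
  have F_nonneg: "F \<ge> 0" using constants M0_nonneg by (simp add: F_def)
  have \<Gamma>_sums: "v \<omega> sums \<Gamma> \<omega>" if "\<omega> \<in> \<Omega> 0" for \<omega>
    unfolding \<Gamma>_def
    using exp_decay_tail_bound(1)[OF constants(2) v[OF that]] by (rule summable_sums)
  have \<Gamma>_tail: "norm (\<Gamma> \<omega> - (\<Sum>j<n. v \<omega> j)) \<le> F * exp (- rate * real n)" if "\<omega> \<in> \<Omega> 0" for \<omega> n
    using exp_decay_tail_bound(2)[OF constants(2) v[OF that], of n] by (simp add: \<Gamma>_def F_def)

  \<comment> \<open>The growth rate in (B4) may be nonpositive; enlarging it makes the orbit separation geometric.\<close>
  define c' where "c' = max c (rate / (2 * (1 + \<zeta>)))"
  have c': "0 < c'" "c \<le> c'" "c' * (1 + \<zeta>) < rate"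
  proof -
    have "0 < rate / (2 * (1 + \<zeta>))" "rate / (2 * (1 + \<zeta>)) < rate / (1 + \<zeta>)"
      using constants by (auto intro!: divide_strict_left_mono mult_pos_pos)
    then have "0 < c'" "c' < rate / (1 + \<zeta>)" using B4(3) by (auto simp: c'_def)
    then show "0 < c'" "c' * (1 + \<zeta>) < rate" using constants by (simp_all add: pos_less_divide_eq)
  qed (simp add: c'_def)
  have c'_\<zeta>: "c' * \<zeta> < rate" using c' by (simp add: algebra_simps)

  \<comment> \<open>Separation of perturbed and unperturbed backward orbits\<close>
  obtain M5 where M5: "M5 > 0"
      "\<forall>\<^sub>F \<epsilon> in at 0 within I. norm (dist_C0 (\<tau> 0) (\<tau> \<epsilon>)) \<le> M5 * norm \<epsilon>"
    using landau_o.bigE[OF B5] unfolding \<tau>_def by blast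
  define N where "N = C * M5 / (exp c' - 1)"
  have N: "N \<ge> 0" using constants M5 c' by (simp add: N_def)
  \<comment> \<open>The constant of \<open>weighted_separation_sum_le\<close> for decay rate
    \<open>rate\<close> and growth rate \<open>c'\<close>.\<close>
  define S where "S p = N powr p * exp (c' * p) / (1 - exp (- (rate - c' * p))) + 1 / (1 - exp (- rate))"
    for p
  have S: "S p \<ge> 0" if "c' * p < rate" for p
    using that constants by (simp add: S_def)
  have separation: "dist ((\<tau> \<epsilon> ^^ k) x) ((\<tau> 0 ^^ k) x) \<le> N * exp (c' * real k) * \<bar>\<epsilon>\<bar>"
    if "norm (dist_C0 (\<tau> 0) (\<tau> \<epsilon>)) \<le> M5 * norm \<epsilon>" for \<epsilon> k x
  proof -
    have "dist (\<tau> \<epsilon> y) (\<tau> 0 y) \<le> M5 * \<bar>\<epsilon>\<bar>" for y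
      using dist_le_dist_C0[OF compact_imp_bounded[OF manifold(1)], of "\<tau> 0" y "\<tau> \<epsilon>"] that
      by (simp add: dist_commute)
    then have "dist ((\<tau> \<epsilon> ^^ k) x) ((\<tau> 0 ^^ k) x) \<le> (\<Sum>i<k. C * exp (c * real i)) * (M5 * \<bar>\<epsilon>\<bar>)"
      using B4(2) unfolding \<tau>_def by (intro dist_funpow_le)
    also have "\<dots> \<le> (\<Sum>i<k. C * exp (c' * real i)) * (M5 * \<bar>\<epsilon>\<bar>)"
      using c' constants M5 by (intro mult_right_mono sum_mono mult_left_mono) (auto intro: mult_right_mono)
    also have "\<dots> \<le> C * (exp (c' * real k) / (exp c' - 1)) * (M5 * \<bar>\<epsilon>\<bar>)"
      unfolding sum_distrib_left[symmetric]
      using constants M5 c' by (intro mult_right_mono mult_left_mono sum_exp_increasing_le) auto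
    finally show ?thesis by (simp add: N_def mult_ac)
  qed

  \<comment> \<open>The estimate for a fixed small parameter\<close>
  define M where "M = 2 * C\<^sup>2 + C * C * C * S (1 + \<zeta>) +
    C * C * K * (M0 * C) * S \<zeta> * ((1 + \<zeta>) / rate + 1) + F"
  have bound: "norm (j\<^sub>s (h \<omega> \<epsilon>) - j\<^sub>s (h \<omega> 0) - \<epsilon> *\<^sub>R \<Gamma> \<omega>) \<le>
      M * (\<bar>ln \<bar>\<epsilon>\<bar>\<bar> * \<bar>\<epsilon>\<bar> powr (1 + \<zeta>))"
    if \<epsilon>: "\<epsilon> \<in> I" "\<epsilon> \<noteq> 0" "\<bar>\<epsilon>\<bar> < exp (- 1)"
      and sep: "norm (dist_C0 (\<tau> 0) (\<tau> \<epsilon>)) \<le> M5 * norm \<epsilon>"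
      and \<omega>: "\<omega> \<in> \<Omega> \<epsilon>" "\<omega> \<in> \<Omega> 0"
    for \<epsilon> \<omega>
  proof -
    define x where "x k = (\<tau> \<epsilon> ^^ k) \<omega>" for k
    define y where "y k = (\<tau> 0 ^^ k) \<omega>" for k
    define d where "d k = dist (x k) (y k)" for k
    define l where "l = \<bar>ln \<bar>\<epsilon>\<bar>\<bar>"
    define e where "e = \<bar>\<epsilon>\<bar> powr (1 + \<zeta>)"
    define n where "n = nat \<lceil>(1 + \<zeta>) / rate * l\<rceil>"
    define b where "b = (\<lambda>k. j\<^sub>s (h (x k) \<epsilon>) - j\<^sub>s (h (y k) 0))"
    \<comment> \<open>One-step defect: both operators act on the unperturbed h, because that is the
      one known to lie in the strongest space, where the derivative estimate holds.\<close>
    define \<Delta> where "\<Delta> k = L\<^sub>s (x (Suc k)) \<epsilon> (h (y (Suc k)) 0) - L\<^sub>s (y (Suc k)) 0 (h (y (Suc k)) 0)" for k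
    define R where "R k = \<Delta> k - \<epsilon> *\<^sub>R q \<omega> k" for k
    note x\<Omega> = \<tau>_\<Omega>[OF \<epsilon>(1) \<omega>(1), folded x_def] and y\<Omega> = \<tau>_\<Omega>[OF I(1) \<omega>(2), folded y_def]
    have \<sigma>x: "\<sigma> \<epsilon> (x (Suc k)) = x k" and \<sigma>y: "\<sigma> 0 (y (Suc k)) = y k" for k
      using \<sigma>\<tau> \<epsilon>(1) I(1) by (simp_all add: x_def y_def)
    \<comment> \<open>The threshold \<open>exp (- 1)\<close> forces \<open>l \<ge> 1\<close>, so
      terms of size \<open>e\<close> are absorbed into \<open>l * e\<close> by
      \<open>le_log\<close>.\<close>
    have ln_neg: "ln \<bar>\<epsilon>\<bar> < - 1" using \<epsilon> ln_less_cancel_iff[of "\<bar>\<epsilon>\<bar>" "exp (- 1)"] by simp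
    then have l: "l \<ge> 1" "ln \<bar>\<epsilon>\<bar> = - l" by (simp_all add: l_def)
    have \<epsilon>1: "\<bar>\<epsilon>\<bar> \<le> 1" using \<epsilon> by (meson exp_le_one_iff less_imp_le neg_le_0_iff_le order_trans zero_le_one)
    have e: "e \<ge> 0" "e = exp (- (1 + \<zeta>) * l)"
      using \<epsilon> l(2) by (simp_all add: e_def powr_def algebra_simps)
    have le_log: "a * e \<le> a * (l * e)" if "a \<ge> 0" for a
      using mult_right_mono[OF l(1) e(1)] that by (intro mult_left_mono) auto
    \<comment> \<open>The lower bound makes \<open>exp (- rate * real n)\<close> at most
      \<open>e\<close>; the upper bound limits the number of summands to a multiple of
      \<open>l\<close>.\<close>
    have real_n: "(1 + \<zeta>) / rate * l \<le> real n" "real n \<le> (1 + \<zeta>) / rate * l + 1"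
    proof -
      have "0 \<le> (1 + \<zeta>) / rate * l" using constants l by simp
      then show "(1 + \<zeta>) / rate * l \<le> real n" "real n \<le> (1 + \<zeta>) / rate * l + 1"
        unfolding n_def by linarith+
    qed
    have n_le: "real n \<le> ((1 + \<zeta>) / rate + 1) * l" using real_n(2) l by (simp add: algebra_simps)
    have "(1 + \<zeta>) * l \<le> rate * real n" using real_n(1) constants by (simp add: field_simps)
    then have decay_n: "exp (- rate * real n) \<le> e" unfolding e(2) by (simp add: algebra_simps)
    have d: "0 \<le> d k" "d k \<le> N * exp (c' * real k) * \<bar>\<epsilon>\<bar>" for k
      unfolding d_def x_def y_def using separation[OF sep] by auto

    \<comment> \<open>Equivariance (A4) on both orbits, after inserting the perturbed operator
      applied to the unperturbed h.\<close>
    have b_step: "b k = L\<^sub>w (x (Suc k)) \<epsilon> (b (Suc k)) + j\<^sub>s (\<Delta> k)" for k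
    proof -
      have "L\<^sub>w (x (Suc k)) \<epsilon> (b (Suc k)) + j\<^sub>s (\<Delta> k) =
          j\<^sub>s (L\<^sub>s (x (Suc k)) \<epsilon> (h (x (Suc k)) \<epsilon>)) - j\<^sub>s (L\<^sub>s (y (Suc k)) 0 (h (y (Suc k)) 0))"
        by (simp add: b_def \<Delta>_def blinfun.diff_right L_restrict \<epsilon>(1))
      also have "\<dots> = b k"
        using A4[OF \<epsilon>(1) x\<Omega>[of "Suc k"]] A4[OF I(1) y\<Omega>[of "Suc k"]] by (simp add: \<sigma>x \<sigma>y b_def)
      finally show ?thesis by simp
    qed
    have b0: "b 0 = j\<^sub>s (h \<omega> \<epsilon>) - j\<^sub>s (h \<omega> 0)" by (simp add: b_def x_def y_def)
    have "b 0 = Lcw \<epsilon> n (x n) (b n) + (\<Sum>k<n. Lcw \<epsilon> k (x k) (j\<^sub>s (\<Delta> k)))"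
      unfolding Lcw_def x_def using b_step unfolding x_def
      by (intro cocycle_telescope \<sigma>\<tau>[OF \<epsilon>(1)])
    also have "(\<Sum>k<n. Lcw \<epsilon> k (x k) (j\<^sub>s (\<Delta> k))) =
        (\<Sum>k<n. Lcw \<epsilon> k (x k) (j\<^sub>s (R k))) + \<epsilon> *\<^sub>R (\<Sum>k<n. Lcw \<epsilon> k (x k) (j\<^sub>s (q \<omega> k)))"
      unfolding scaleR_sum_right sum.distrib[symmetric]
      by (intro sum.cong) (simp_all add: R_def blinfun.diff_right blinfun.scaleR_right)
    finally have "j\<^sub>s (h \<omega> \<epsilon>) - j\<^sub>s (h \<omega> 0) - \<epsilon> *\<^sub>R \<Gamma> \<omega> =
        Lcw \<epsilon> n (x n) (b n) + (\<Sum>k<n. Lcw \<epsilon> k (x k) (j\<^sub>s (R k))) +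
        \<epsilon> *\<^sub>R (\<Sum>k<n. Lcw \<epsilon> k (x k) (j\<^sub>s (q \<omega> k)) - v \<omega> k) - \<epsilon> *\<^sub>R (\<Gamma> \<omega> - (\<Sum>k<n. v \<omega> k))"
      by (simp add: b0 sum_subtractf scaleR_diff_right)
    \<comment> \<open>The four norms are the far end of the telescope, the derivative remainders,
      the exchange of cocycles and the tail of the series. They match the four summands of
      \<open>M\<close> in this order.\<close>
    then have split: "norm (j\<^sub>s (h \<omega> \<epsilon>) - j\<^sub>s (h \<omega> 0) - \<epsilon> *\<^sub>R \<Gamma> \<omega>) \<le>
        norm (Lcw \<epsilon> n (x n) (b n)) + norm (\<Sum>k<n. Lcw \<epsilon> k (x k) (j\<^sub>s (R k))) +
        norm (\<epsilon> *\<^sub>R (\<Sum>k<n. Lcw \<epsilon> k (x k) (j\<^sub>s (q \<omega> k)) - v \<omega> k)) +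
        norm (\<epsilon> *\<^sub>R (\<Gamma> \<omega> - (\<Sum>k<n. v \<omega> k)))"
      by (smt (verit) norm_triangle_ineq norm_triangle_ineq4)

    have "norm (Lcw \<epsilon> n (x n) (b n)) \<le> C * exp (- rate * real n) * (2 * C)"
      unfolding x_def
    proof (rule Lcw_decay[OF \<epsilon>(1) \<omega>(1)])
      \<comment> \<open>Both densities are normalised by (A3), so their difference lies in the
        kernel of \<psi> and (A1) applies.\<close>
      show "\<psi> (b n) = 0" using A3 x\<Omega> y\<Omega> \<epsilon>(1) I(1) by (simp add: b_def blinfun.diff_right)
      have "norm (j\<^sub>s (h (x n) \<epsilon>)) \<le> C" "norm (j\<^sub>s (h (y n) 0)) \<le> C"
        using A3[OF \<epsilon>(1) x\<Omega>[of n]] A3[OF I(1) y\<Omega>[of n]] embed(2) order_trans by blast+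
      then show "norm (b n) \<le> 2 * C"
        unfolding b_def using norm_triangle_ineq4[of "j\<^sub>s (h (x n) \<epsilon>)" "j\<^sub>s (h (y n) 0)"] by linarith
    qed
    also have "\<dots> \<le> C * e * (2 * C)"
      using decay_n constants by (intro mult_right_mono mult_left_mono) auto
    also have "\<dots> \<le> 2 * C\<^sup>2 * (l * e)"
      using le_log[of "2 * C\<^sup>2"] by (simp add: power2_eq_square mult_ac)
    finally have T1: "norm (Lcw \<epsilon> n (x n) (b n)) \<le> 2 * C\<^sup>2 * (l * e)" .

    have \<psi>_\<Delta>: "\<psi> (j\<^sub>s (\<Delta> k)) = 0" for k
      using \<psi>_L \<epsilon>(1) I(1) by (simp add: \<Delta>_def blinfun.diff_right flip: L_restrict)
    \<comment> \<open>\<open>\<Lambda> \<omega> k\<close> is the derivative along the curve of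
      (k+1)-st preimages, which runs through \<open>y (Suc k)\<close> at 0 and
      \<open>x (Suc k)\<close> at \<epsilon>; hence the distance in its remainder is
      \<open>d (Suc k)\<close>.\<close>
    have R_norm: "norm (R k) \<le> C * (d (Suc k) powr (1 + \<zeta>) + e) * C" for k
    proof -
      have hy: "h (y (Suc k)) 0 = j\<^sub>s\<^sub>s (h\<^sub>s\<^sub>s (y (Suc k)))" "norm (h\<^sub>s\<^sub>s (y (Suc k))) \<le> C"
        using B2[OF y\<Omega>] by auto
      have "norm (R k) \<le> C * (\<bar>\<epsilon>\<bar> powr (1 + \<zeta>) + d (Suc k) powr (1 + \<zeta>)) * norm (h\<^sub>s\<^sub>s (y (Suc k)))"
        using \<Lambda>[of k \<omega>] \<epsilon>(1) hy(1)
        by (auto simp: is_param_derivative_def R_def \<Delta>_def q_def d_def x_def y_def \<tau>_def blinfun.diff_left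
            simp del: funpow.simps)
      also have "\<dots> \<le> C * (\<bar>\<epsilon>\<bar> powr (1 + \<zeta>) + d (Suc k) powr (1 + \<zeta>)) * C"
        using hy(2) constants by (intro mult_left_mono) auto
      finally show ?thesis by (simp add: e_def add.commute)
    qed
    have "norm (\<Sum>k<n. Lcw \<epsilon> k (x k) (j\<^sub>s (R k))) \<le>
        (\<Sum>k<n. C * exp (- rate * real k) * (C * (d (Suc k) powr (1 + \<zeta>) + e) * C))"
      unfolding x_def
    proof (intro sum_norm_le Lcw_decay[OF \<epsilon>(1) \<omega>(1)])
      show "\<psi> (j\<^sub>s (R k)) = 0" for k
        using \<psi>_\<Delta> q by (simp add: R_def blinfun.diff_right blinfun.scaleR_right)
      show "norm (j\<^sub>s (R k)) \<le> C * (d (Suc k) powr (1 + \<zeta>) + e) * C" for k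
        using embed(2) R_norm by (rule order_trans)
    qed
    also have "\<dots> = C * C * C * (\<Sum>k<n. exp (- rate * real k) * (d (Suc k) powr (1 + \<zeta>) + \<bar>\<epsilon>\<bar> powr (1 + \<zeta>)))"
      unfolding sum_distrib_left e_def by (simp add: mult_ac)
    also have "\<dots> \<le> C * C * C * (S (1 + \<zeta>) * e)"
      unfolding S_def e_def using constants c' N d
      by (intro mult_left_mono weighted_separation_sum_le) auto
    also have "\<dots> \<le> C * C * C * S (1 + \<zeta>) * (l * e)"
      using le_log[of "C * C * C * S (1 + \<zeta>)"] S c' constants by (simp add: mult_ac)
    finally have T2: "norm (\<Sum>k<n. Lcw \<epsilon> k (x k) (j\<^sub>s (R k))) \<le> C * C * C * S (1 + \<zeta>) * (l * e)" .

    \<comment> \<open>(A2) loses from the strong to the weak norm. So the inner factor must be the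
      unperturbed cocycle, bounded strongly by (B1), while the outer perturbed one supplies weak
      decay by (A1). The resulting bound does not depend on k.\<close>
    have shadow: "norm (Lcw \<epsilon> k (x k) (j\<^sub>s (q \<omega> k)) - v \<omega> k) \<le> C * C * K * (M0 * C) * S \<zeta> * \<bar>\<epsilon>\<bar> powr \<zeta>" for k
    proof -
      define w where "w i = Lcs (k - Suc i) (y k) (q \<omega> k)" for i
      define z where "z i = (L\<^sub>w (x (Suc i)) \<epsilon> - L\<^sub>w (y (Suc i)) 0) (j\<^sub>s (w i))" for i
      have "Lcw \<epsilon> k (x k) (j\<^sub>s (q \<omega> k)) - v \<omega> k = (\<Sum>i<k. Lcw \<epsilon> i (x i) (z i))"
        unfolding v_def z_def w_def Lcw_js[symmetric] unfolding Lcw_def x_def y_def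
        by (intro cocycle_diff \<sigma>\<tau> \<epsilon>(1) I(1))
      also have "norm \<dots> \<le> (\<Sum>i<k. C * exp (- rate * real i) *
          (C * (d (Suc i) powr \<zeta> + \<bar>\<epsilon>\<bar> powr \<zeta>) * (K * (M0 * C))))"
        unfolding x_def
      proof (intro sum_norm_le Lcw_decay[OF \<epsilon>(1) \<omega>(1)])
        fix i
        show "\<psi> (z i) = 0"
          using \<psi>_L \<epsilon>(1) I(1) by (simp add: z_def blinfun.diff_left blinfun.diff_right)
        have "norm (w i) \<le> norm (Lcs (k - Suc i) (y k)) * norm (q \<omega> k)"
          unfolding w_def by (rule norm_blinfun)
        also have "\<dots> \<le> K * (M0 * C)"
          unfolding Lcs_def using B1 y\<Omega> q_norm[OF \<omega>(2)] by (intro mult_mono) auto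
        finally have w: "norm (w i) \<le> K * (M0 * C)" .
        have "norm (z i) \<le> C * (d (Suc i) powr \<zeta> + \<bar>\<epsilon>\<bar> powr \<zeta>) * norm (w i)"
          unfolding z_def d_def blinfun.diff_left by (intro A2 \<epsilon>(1) x\<Omega> y\<Omega>)
        also have "\<dots> \<le> C * (d (Suc i) powr \<zeta> + \<bar>\<epsilon>\<bar> powr \<zeta>) * (K * (M0 * C))"
          using w constants by (intro mult_left_mono) auto
        finally show "norm (z i) \<le> C * (d (Suc i) powr \<zeta> + \<bar>\<epsilon>\<bar> powr \<zeta>) * (K * (M0 * C))" .
      qed
      also have "\<dots> = C * C * K * (M0 * C) *
          (\<Sum>i<k. exp (- rate * real i) * (d (Suc i) powr \<zeta> + \<bar>\<epsilon>\<bar> powr \<zeta>))"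
        unfolding sum_distrib_left by (simp add: mult_ac)
      also have "\<dots> \<le> C * C * K * (M0 * C) * (S \<zeta> * \<bar>\<epsilon>\<bar> powr \<zeta>)"
        unfolding S_def using constants c'_\<zeta> N d B1(1) M0_nonneg
        by (intro mult_left_mono weighted_separation_sum_le) auto
      finally show ?thesis by (simp add: mult_ac)
    qed
    define Q where "Q = C * C * K * (M0 * C) * S \<zeta>"
    have Q: "Q \<ge> 0" using constants B1(1) M0_nonneg S[OF c'_\<zeta>] by (simp add: Q_def)
    \<comment> \<open>The prefactor \<epsilon> raises the exponent from \<zeta> to
      \<open>1 + \<zeta>\<close>; summing n equal bounds then produces the logarithm.\<close>
    have \<epsilon>e: "\<bar>\<epsilon>\<bar> * \<bar>\<epsilon>\<bar> powr \<zeta> = e" using \<epsilon>(2) by (simp add: e_def powr_add)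
    have "norm (\<Sum>k<n. Lcw \<epsilon> k (x k) (j\<^sub>s (q \<omega> k)) - v \<omega> k) \<le> (\<Sum>k<n. Q * \<bar>\<epsilon>\<bar> powr \<zeta>)"
      unfolding Q_def by (intro sum_norm_le shadow)
    then have "norm (\<epsilon> *\<^sub>R (\<Sum>k<n. Lcw \<epsilon> k (x k) (j\<^sub>s (q \<omega> k)) - v \<omega> k)) \<le>
        \<bar>\<epsilon>\<bar> * (\<Sum>k<n. Q * \<bar>\<epsilon>\<bar> powr \<zeta>)"
      unfolding norm_scaleR by (intro mult_left_mono) auto
    also have "\<dots> = Q * e * real n"
      by (simp add: mult_ac flip: \<epsilon>e)
    also have "\<dots> \<le> Q * e * (((1 + \<zeta>) / rate + 1) * l)"
      using Q e(1) n_le by (intro mult_left_mono) auto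
    finally have T3: "norm (\<epsilon> *\<^sub>R (\<Sum>k<n. Lcw \<epsilon> k (x k) (j\<^sub>s (q \<omega> k)) - v \<omega> k)) \<le>
        Q * ((1 + \<zeta>) / rate + 1) * (l * e)"
      by (simp only: mult_ac)

    \<comment> \<open>The tail alone is already of size \<open>e\<close> by the choice of n, so the
      factor \<epsilon> is bounded by 1.\<close>
    have "norm (\<epsilon> *\<^sub>R (\<Gamma> \<omega> - (\<Sum>k<n. v \<omega> k))) \<le> 1 * (F * exp (- rate * real n))"
      unfolding norm_scaleR using \<epsilon>1 \<Gamma>_tail[OF \<omega>(2)] by (intro mult_mono) auto
    also have "\<dots> \<le> F * e" using decay_n F_nonneg by (simp add: mult_left_mono)
    also have "\<dots> \<le> F * (l * e)"
      using F_nonneg by (rule le_log)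
    finally have T4: "norm (\<epsilon> *\<^sub>R (\<Gamma> \<omega> - (\<Sum>k<n. v \<omega> k))) \<le> F * (l * e)" .

    have "M * (l * e) = 2 * C\<^sup>2 * (l * e) + C * C * C * S (1 + \<zeta>) * (l * e) +
        Q * ((1 + \<zeta>) / rate + 1) * (l * e) + F * (l * e)"
      unfolding M_def Q_def by (simp only: distrib_right)
    with split T1 T2 T3 T4 show ?thesis unfolding l_def[symmetric] e_def[symmetric] by linarith
  qed

  have "\<forall>\<^sub>F \<epsilon> in at 0 within I. \<epsilon> \<in> I \<and> \<epsilon> \<noteq> 0 \<and> \<bar>\<epsilon>\<bar> < exp (- 1)"
    unfolding eventually_at by (rule exI[of _ "exp (- 1)"]) auto
  with M5(2) have "\<forall>\<^sub>F \<epsilon> in at 0 within I. \<forall>\<omega>\<in>\<Omega> \<epsilon> \<inter> \<Omega> 0.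
      norm (j\<^sub>s (h \<omega> \<epsilon>) - j\<^sub>s (h \<omega> 0) - \<epsilon> *\<^sub>R \<Gamma> \<omega>) \<le> M * (\<bar>ln \<bar>\<epsilon>\<bar>\<bar> * \<bar>\<epsilon>\<bar> powr (1 + \<zeta>))"
    by eventually_elim (auto intro: bound)
  \<comment> \<open>The tail after zero terms is the whole series.\<close>
  moreover have "norm (\<Gamma> \<omega>) \<le> F" if "\<omega> \<in> \<Omega> 0" for \<omega>
    using \<Gamma>_tail[OF that, of 0] by simp
  moreover have "(\<lambda>j. j\<^sub>s (cocycle (\<sigma> 0) (\<lambda>\<omega>. L\<^sub>s \<omega> 0) j ((inv (\<sigma> 0) ^^ j) \<omega>)
      (\<Lambda> \<omega> j (h\<^sub>s\<^sub>s ((inv (\<sigma> 0) ^^ (j + 1)) \<omega>))))) sums \<Gamma> \<omega>" if "\<omega> \<in> \<Omega> 0" for \<omega>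
    using \<Gamma>_sums[OF that] unfolding v_def Lcw_js by (simp add: q_def Lcs_def \<tau>_def)
  ultimately show ?thesis by blast
qed

end
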